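(* For every $0\le\varepsilon<1$ and every integer $n\ge1$ there is an instance of the correlated prophet inequality with $n$ rewards, i.e. a distribution $F$ over $\mathbb{R}_{\ge0}^n$, for which the $(1-\varepsilon)$-competition complexity of any online algorithm (under block arrival) is at least $n-n\cdot\varepsilon-1$.
   Context: Let $F$ be a known joint distribution over $v=(v_1,\dots,v_n)\in\mathbb{R}_{\ge0}^n$ (arbitrary correlations allowed). Given $k$ i.i.d. copies $v^{(1)},\dots,v^{(k)}\sim F$, the $nk$ rewards are revealed one by one in the order $v^{(1)}_1,\dots,v^{(1)}_n,v^{(2)}_1,\dots,v^{(k)}_n$ (block arrival). A (possibly randomized) online algorithm $\mathrm{ALG}$, which may depend on $F$ and on the number $k$ of copies, must upon seeing each reward decide irrevocably to select it and stop, or to discard it; $\mathrm{ALG}(v)$ is the selected value ($0$ if none). The $(1-\varepsilon)$-competition complexity of $\mathrm{ALG}$ on the instance $F$ is the smallest positive integer $k_0$ such that for every $k\ge k_0$, $\mathbb{E}_{v\sim F^k}[\mathrm{ALG}(v)]\ge(1-\varepsilon)\,\mathbb{E}_{v\sim F}[\max_i v_i]$ (and $\infty$ if no such $k_0$ exists). *)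

theory Defs
  imports "HOL-Probability.Probability"
begin

text \<open>
  Rewards and copies are indexed from 0: the coordinate \<open>v i\<close> with \<open>i < n\<close> is the reward
  \<open>v\<^sub>i\<^sub>+\<^sub>1\<close>.  Expectations of nonnegative rewards are taken in \<open>ennreal\<close>, so that no
  integrability convention is involved.
\<close>

definition correlated_instance :: "nat \<Rightarrow> (nat \<Rightarrow> real) measure \<Rightarrow> bool" where
  "correlated_instance n F \<longleftrightarrow>
     prob_space F \<and>
     sets F = sets (Pi\<^sub>M {..<n} (\<lambda>_. borel)) \<and>
     (AE v in F. \<forall>i<n. 0 \<le> v i)"

definition prophet_value :: "nat \<Rightarrow> (nat \<Rightarrow> real) measure \<Rightarrow> ennreal" where
  "prophet_value n F = (\<integral>\<^sup>+ v. ennreal (Max (v ` {..<n})) \<partial>F)"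

text \<open>
  A randomized online algorithm draws an internal seed \<open>r\<close>, independently of the rewards.
  If no earlier reward was selected, it selects the reward arriving at time \<open>t\<close> iff
  \<open>accept A t r h\<close> holds, where \<open>h\<close> is the history of the rewards at times \<open>0, \<dots>, t\<close>.
  Deterministic algorithms are those that ignore the seed.
\<close>

record 'r online_algorithm =
  seed :: "'r measure"
  accept :: "nat \<Rightarrow> 'r \<Rightarrow> (nat \<Rightarrow> real) \<Rightarrow> bool"

definition valid_algorithm :: "nat \<Rightarrow> 'r online_algorithm \<Rightarrow> bool" where
  "valid_algorithm N A \<longleftrightarrow>
     prob_space (seed A) \<and>
     (\<forall>t<N. (\<lambda>(r, h). accept A t r h)
        \<in> measurable (seed A \<Otimes>\<^sub>M Pi\<^sub>M {..t} (\<lambda>_. borel)) (count_space UNIV))"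

text \<open>
  The restriction of the reward sequence \<open>x\<close> to \<open>{..t}\<close> hides all future rewards from the
  decision at time \<open>t\<close>.
\<close>

definition selects :: "'r online_algorithm \<Rightarrow> 'r \<Rightarrow> (nat \<Rightarrow> real) \<Rightarrow> nat \<Rightarrow> bool" where
  "selects A r x t \<longleftrightarrow> accept A t r (restrict x {..t})"

definition selected_value :: "nat \<Rightarrow> 'r online_algorithm \<Rightarrow> 'r \<Rightarrow> (nat \<Rightarrow> real) \<Rightarrow> real" where
  "selected_value N A r x =
     (if \<exists>t<N. selects A r x t then x (LEAST t. t < N \<and> selects A r x t) else 0)"

text \<open>The copies are revealed one after the other, each in its coordinate order.\<close>

definition block_arrival :: "nat \<Rightarrow> (nat \<Rightarrow> nat \<Rightarrow> real) \<Rightarrow> nat \<Rightarrow> real" where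
  "block_arrival n w t = w (t div n) (t mod n)"

definition algorithm_value ::
    "nat \<Rightarrow> (nat \<Rightarrow> real) measure \<Rightarrow> nat \<Rightarrow> 'r online_algorithm \<Rightarrow> ennreal" where
  "algorithm_value n F k A =
     (\<integral>\<^sup>+ (r, w). ennreal (selected_value (n * k) A r (block_arrival n w))
        \<partial>(seed A \<Otimes>\<^sub>M Pi\<^sub>M {..<k} (\<lambda>_. F)))"

text \<open>
  \<open>A k\<close> is the algorithm that is run when there are \<open>k\<close> copies.
\<close>

definition sufficient_copies ::
    "real \<Rightarrow> nat \<Rightarrow> (nat \<Rightarrow> real) measure \<Rightarrow> (nat \<Rightarrow> 'r online_algorithm) \<Rightarrow> nat \<Rightarrow> bool" where
  "sufficient_copies \<epsilon> n F A k0 \<longleftrightarrow>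
     1 \<le> k0 \<and>
     (\<forall>k\<ge>k0. algorithm_value n F k (A k) \<ge> ennreal (1 - \<epsilon>) * prophet_value n F)"

definition competition_complexity ::
    "real \<Rightarrow> nat \<Rightarrow> (nat \<Rightarrow> real) measure \<Rightarrow> (nat \<Rightarrow> 'r online_algorithm) \<Rightarrow> enat" where
  "competition_complexity \<epsilon> n F A =
     (if \<exists>k0. sufficient_copies \<epsilon> n F A k0
      then enat (LEAST k0. sufficient_copies \<epsilon> n F A k0) else \<infinity>)"

end

theory Submission
  imports Defs
begin

text \<open>
  Let \<open>m = n + 1\<close> and let the \<open>i\<close>-th reward be \<open>m\<^sup>i\<close> up to a random index and \<open>0\<close> afterwards, being
  nonzero with probability \<open>m\<^sup>-\<^sup>i\<close>, so that every reward has mean \<open>1\<close>.  As the nonzero rewards grow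
  geometrically, the maximum is at least \<open>1 - 1/m\<close> times their sum, and the prophet gets at least
  \<open>n (1 - 1/m)\<close>.  Within a copy the rewards follow a fixed path until they vanish, so the index at which
  an algorithm collects something positive from that copy is determined by its seed and the other
  copies: it gets at most \<open>1\<close> from each copy in expectation.  Hence \<open>k\<close> copies are worth at most
  \<open>k\<close>, and matching \<open>1 - \<epsilon>\<close> times the prophet requires \<open>k \<ge> (1 - \<epsilon>) n (1 - 1/m)\<close>.
\<close>

section \<open>Online gain on instances whose copies follow a fixed path\<close>

text \<open>Overwriting copy \<open>c\<close> by \<open>p\<close> removes all dependence on
  \<open>w c\<close>, so independence of the copies can be used without conditioning. Selections in
  earlier copies are deliberately ignored: this can only overcount, which is harmless for an upper
  bound.\<close>

definition first_accepted_on_path ::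
    "'r online_algorithm \<Rightarrow> nat \<Rightarrow> (nat \<Rightarrow> real) \<Rightarrow> nat \<Rightarrow> 'r \<Rightarrow> (nat \<Rightarrow> nat \<Rightarrow> real) \<Rightarrow> nat \<Rightarrow> bool" where
  "first_accepted_on_path A n p c r w i \<longleftrightarrow>
     selects A r (block_arrival n (w(c := p))) (c * n + i) \<and>
     (\<forall>j<i. \<not> selects A r (block_arrival n (w(c := p))) (c * n + j))"

lemma first_accepted_on_path_unique:
  assumes "first_accepted_on_path A n p c r w i" "first_accepted_on_path A n p c r w j"
  shows "i = j"
  using assms unfolding first_accepted_on_path_def by (meson linorder_neqE_nat)

text \<open>The second update of \<open>w\<close> at \<open>c\<close> discards the first. This is
  the form in which the accepted index is independent of the rewards in copy
  \<open>c\<close>.\<close>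

lemma first_accepted_on_path_upd [simp]:
  "first_accepted_on_path A n p c r (w(c := v)) = first_accepted_on_path A n p c r w"
  by (simp add: first_accepted_on_path_def fun_eq_iff)

lemma sum_first_accepted_on_path_le:
  "(\<Sum>i<n. C * of_bool (first_accepted_on_path A n p c r w i)) \<le> (C :: ennreal)"
proof (cases "\<exists>i<n. first_accepted_on_path A n p c r w i")
  case True
  then obtain i where i: "i < n" "first_accepted_on_path A n p c r w i" by blast
  have "first_accepted_on_path A n p c r w j \<longleftrightarrow> j = i" for j
    using i first_accepted_on_path_unique by metis
  then have "(\<Sum>j<n. C * of_bool (first_accepted_on_path A n p c r w j)) = (\<Sum>j<n. if j = i then C else 0)"
    by (intro sum.cong) auto
  also have "\<dots> = C" using i by simp
  finally show ?thesis by simp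
next
  case False
  then show ?thesis by simp
qed

text \<open>A nonzero selected reward at index \<open>i\<close> of copy \<open>c\<close> forces that
  copy to agree with \<open>p\<close> up to \<open>i\<close>. The algorithm has then seen exactly
  the history of the overwritten sequence, so \<open>i\<close> is also the first index accepted
  there, and the selected value is one of the summands.\<close>

lemma selected_value_le_path_sum:
  fixes w :: "nat \<Rightarrow> nat \<Rightarrow> real"
  assumes path: "\<And>c i. c < k \<Longrightarrow> i < n \<Longrightarrow> w c i = 0 \<or> (\<forall>j\<le>i. w c j = p j)"
  shows "ennreal (selected_value (n * k) A r (block_arrival n w))
    \<le> (\<Sum>c<k. \<Sum>i<n. ennreal (w c i) * of_bool (first_accepted_on_path A n p c r w i))"
    (is "?L \<le> ?R")
proof (cases "\<exists>t<n * k. selects A r (block_arrival n w) t")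
  case False
  then have "selected_value (n * k) A r (block_arrival n w) = 0"
    unfolding selected_value_def by (rule if_not_P)
  then show ?thesis by simp
next
  case True
  define t where "t = (LEAST t. t < n * k \<and> selects A r (block_arrival n w) t)"
  have t: "t < n * k" "selects A r (block_arrival n w) t"
    using LeastI_ex[OF True] by (auto simp: t_def)
  have early: "\<not> selects A r (block_arrival n w) s" if "s < t" for s
    using not_less_Least[of s "\<lambda>t. t < n * k \<and> selects A r (block_arrival n w) t"] that t(1)
    by (auto simp: t_def)
  define c i where "c = t div n" and "i = t mod n"
  have "n > 0" using t(1) by (cases n) auto
  then have ci: "c < k" "i < n" "t = c * n + i"
    using t(1) by (auto simp: c_def i_def less_mult_imp_div_less mult.commute)
  have L: "?L = ennreal (w c i)"
    using True by (auto simp: selected_value_def t_def[symmetric] block_arrival_def c_def i_def)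
  show ?thesis
  proof (cases "w c i = 0")
    case True
    then show ?thesis by (simp add: L)
  next
    case False
    then have on_path: "w c j = p j" if "j \<le> i" for j
      using path ci that by blast
    \<comment> \<open>Up to time \<open>t\<close> only the indices up to \<open>i\<close> of copy
      \<open>c\<close> have been revealed, and there the copy coincides with
      \<open>p\<close>.\<close>
    have "block_arrival n (w(c := p)) s = block_arrival n w s" if "s \<le> t" for s
    proof (cases "s div n = c")
      case True
      then have "s mod n \<le> i"
        using that ci(3) div_mult_mod_eq[of s n] by simp
      then show ?thesis using True on_path by (simp add: block_arrival_def)
    qed (simp add: block_arrival_def)
    then have "restrict (block_arrival n (w(c := p))) {..s} = restrict (block_arrival n w) {..s}"
      if "s \<le> t" for s
      using that by (intro restrict_ext) auto
    then have "selects A r (block_arrival n (w(c := p))) s = selects A r (block_arrival n w) s"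
      if "s \<le> t" for s
      using that by (simp add: selects_def)
    then have "first_accepted_on_path A n p c r w i"
      using t early ci(3) by (simp add: first_accepted_on_path_def)
    then have "?L \<le> ennreal (w c i) * of_bool (first_accepted_on_path A n p c r w i)"
      by (simp add: L)
    also have "\<dots> \<le> (\<Sum>i<n. ennreal (w c i) * of_bool (first_accepted_on_path A n p c r w i))"
      using ci by (intro member_le_sum) auto
    also have "\<dots> \<le> ?R"
      using ci by (intro member_le_sum[of c "{..<k}" "\<lambda>c. \<Sum>i<n. ennreal (w c i) * of_bool (first_accepted_on_path A n p c r w i)"]) auto
    finally show ?thesis .
  qed
qed

lemma measurable_copy_component:
  assumes F: "sets F = sets (Pi\<^sub>M {..<n} (\<lambda>_. borel))" and "c < k" "i < n"
  shows "(\<lambda>w. w c i) \<in> borel_measurable (Pi\<^sub>M {..<k} (\<lambda>_. F))"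
proof -
  have "(\<lambda>w. w c) \<in> measurable (Pi\<^sub>M {..<k} (\<lambda>_. F)) F"
    using assms by (intro measurable_component_singleton) auto
  moreover have "(\<lambda>v. v i) \<in> borel_measurable F"
    using assms by (subst measurable_cong_sets[OF F refl]) (auto intro!: measurable_component_singleton)
  ultimately show ?thesis by (rule measurable_compose)
qed

text \<open>The decision at each time is a measurable function of seed and history; it is composed
  with the map that sends the seed and the copies to the seed and the overwritten history.\<close>

lemma measurable_first_accepted_on_path:
  assumes F: "sets F = sets (Pi\<^sub>M {..<n} (\<lambda>_. borel))"
    and A: "valid_algorithm (n * k) A" and "c < k" "i < n"
  shows "Measurable.pred (seed A \<Otimes>\<^sub>M Pi\<^sub>M {..<k} (\<lambda>_. F))
    (\<lambda>(r, w). first_accepted_on_path A n p c r w i)"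
proof -
  let ?W = "Pi\<^sub>M {..<k} (\<lambda>_. F)"
  have sel: "Measurable.pred (seed A \<Otimes>\<^sub>M ?W)
      (\<lambda>x. selects A (fst x) (block_arrival n ((snd x)(c := p))) (c * n + j))" if "j < n" for j
  proof -
    define t where "t = c * n + j"
    have "t < Suc c * n" using that by (simp add: t_def)
    also have "\<dots> \<le> k * n" using \<open>c < k\<close> by (intro mult_le_mono1) simp
    finally have t: "t < n * k" by (simp add: mult.commute)
    have comp: "(\<lambda>x. block_arrival n ((snd x)(c := p)) s) \<in> borel_measurable (seed A \<Otimes>\<^sub>M ?W)"
      if "s \<le> t" for s
    \<comment> \<open>Entries inside the overwritten copy are constants from \<open>p\<close>; the
      others are coordinates of the product space.\<close>
    proof (cases "s div n = c")
      case True
      then show ?thesis by (simp add: block_arrival_def)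
    next
      case False
      have "s div n < k" "s mod n < n"
        using that t \<open>i < n\<close> by (auto simp: less_mult_imp_div_less mult.commute)
      then show ?thesis
        using False measurable_compose[OF measurable_snd measurable_copy_component[OF F]]
        by (simp add: block_arrival_def)
    qed
    have hist: "(\<lambda>x. (fst x, restrict (block_arrival n ((snd x)(c := p))) {..t}))
        \<in> measurable (seed A \<Otimes>\<^sub>M ?W) (seed A \<Otimes>\<^sub>M Pi\<^sub>M {..t} (\<lambda>_. borel))"
      using comp by (intro measurable_Pair measurable_restrict) auto
    have acc: "(\<lambda>x. accept A t (fst x) (snd x))
        \<in> measurable (seed A \<Otimes>\<^sub>M Pi\<^sub>M {..t} (\<lambda>_. borel)) (count_space UNIV)"
      using A t by (simp add: valid_algorithm_def case_prod_unfold)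
    show ?thesis
      using measurable_compose[OF hist acc] by (simp add: selects_def t_def)
  qed
  have "Measurable.pred (seed A \<Otimes>\<^sub>M ?W)
      (\<lambda>x. \<forall>j\<in>{..<i}. \<not> selects A (fst x) (block_arrival n ((snd x)(c := p))) (c * n + j))"
    using sel \<open>i < n\<close> by (intro pred_intros_finite pred_intros_logic) auto
  then have "Measurable.pred (seed A \<Otimes>\<^sub>M ?W)
      (\<lambda>x. selects A (fst x) (block_arrival n ((snd x)(c := p))) (c * n + i) \<and>
        (\<forall>j\<in>{..<i}. \<not> selects A (fst x) (block_arrival n ((snd x)(c := p))) (c * n + j)))"
    by (rule pred_intros_logic(3)[OF sel[OF \<open>i < n\<close>]])
  then show ?thesis
    by (simp add: first_accepted_on_path_def case_prod_unfold Ball_def)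
qed

text \<open>A null set \<open>Z\<close> of \<open>N\<close> lifts to the null rectangle
  \<open>space M \<times> Z\<close>. This carries the path property from the copies to the joint
  space with the seed.\<close>

lemma AE_pair_snd:
  assumes "sigma_finite_measure N" "AE y in N. P y"
  shows "AE x in M \<Otimes>\<^sub>M N. P (snd x)"
proof -
  interpret N: sigma_finite_measure N by fact
  obtain Z where Z: "{y \<in> space N. \<not> P y} \<subseteq> Z" "emeasure N Z = 0" "Z \<in> sets N"
    using assms(2) by (rule AE_E)
  show ?thesis
  proof (rule AE_I)
    show "{x \<in> space (M \<Otimes>\<^sub>M N). \<not> P (snd x)} \<subseteq> space M \<times> Z"
      using Z(1) by (auto simp: space_pair_measure)
    show "emeasure (M \<Otimes>\<^sub>M N) (space M \<times> Z) = 0"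
      using Z by (simp add: N.emeasure_pair_measure_Times)
    show "space M \<times> Z \<in> sets (M \<Otimes>\<^sub>M N)"
      using Z by simp
  qed
qed

text \<open>The path sum is integrated copy by copy, with the seed outermost and the examined copy
  innermost. There the indicators are constants and at most one of them is 1, so each copy
  contributes at most one mean.\<close>

lemma algorithm_value_le:
  fixes C :: ennreal
  assumes F: "correlated_instance n F"
    and path: "AE v in F. \<forall>i<n. v i = 0 \<or> (\<forall>j\<le>i. v j = p j)"
    and mean: "\<And>i. i < n \<Longrightarrow> (\<integral>\<^sup>+ v. ennreal (v i) \<partial>F) \<le> C"
    and A: "valid_algorithm (n * k) A"
  shows "algorithm_value n F k A \<le> of_nat k * C"
proof -
  let ?W = "Pi\<^sub>M {..<k} (\<lambda>_. F)"
  let ?acc = "\<lambda>c i r w. of_bool (first_accepted_on_path A n p c r w i) :: ennreal"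
  have setsF: "sets F = sets (Pi\<^sub>M {..<n} (\<lambda>_. borel))" and "prob_space F"
    using F by (auto simp: correlated_instance_def)
  interpret F: prob_space F by fact
  interpret P: product_prob_space "\<lambda>_. F" "{..<k}" ..
  interpret S: prob_space "seed A" using A by (simp add: valid_algorithm_def)
  interpret SW: pair_prob_space "seed A" ?W ..
  have comp: "(\<lambda>v. v i) \<in> borel_measurable F" if "i < n" for i
    using that by (subst measurable_cong_sets[OF setsF refl]) (auto intro!: measurable_component_singleton)
  have acc: "(\<lambda>(r, w). ?acc c i r w) \<in> borel_measurable (seed A \<Otimes>\<^sub>M ?W)" if "c < k" "i < n" for c i
  proof -
    have [measurable]: "Measurable.pred (seed A \<Otimes>\<^sub>M ?W) (\<lambda>x. first_accepted_on_path A n p c (fst x) (snd x) i)"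
      using measurable_first_accepted_on_path[OF setsF A that] by (simp add: case_prod_beta)
    show ?thesis by (simp add: case_prod_beta of_bool_def)
  qed
  have gain: "(\<lambda>(r, w). \<Sum>i<n. ennreal (w c i) * ?acc c i r w) \<in> borel_measurable (seed A \<Otimes>\<^sub>M ?W)"
    if "c < k" for c
    using that acc measurable_compose[OF measurable_snd measurable_copy_component[OF setsF]]
    unfolding case_prod_beta
    by (intro borel_measurable_sum borel_measurable_times_ennreal measurable_compose[OF _ measurable_ennreal]) auto
  have copy_le: "(\<integral>\<^sup>+ w. (\<Sum>i<n. ennreal (w c i) * ?acc c i r w) \<partial>?W) \<le> C"
    if "c < k" "r \<in> space (seed A)" for c r
  proof -
    let ?I = "{..<k} - {c}"
    have k: "{..<k} = insert c ?I" using that by auto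
    interpret PI: prob_space "Pi\<^sub>M ?I (\<lambda>_. F)" by (rule prob_space_PiM) (rule \<open>prob_space F\<close>)
    have "(\<lambda>w. \<Sum>i<n. ennreal (w c i) * ?acc c i r w) \<in> borel_measurable ?W"
      using measurable_Pair2[OF gain[OF that(1)] that(2)] by simp
    \<comment> \<open>Copy \<open>c\<close> is split off as an inner variable \<open>v\<close>; by
      \<open>first_accepted_on_path_upd\<close> it occurs only in the rewards, not in the
      indicators.\<close>
    then have "(\<integral>\<^sup>+ w. (\<Sum>i<n. ennreal (w c i) * ?acc c i r w) \<partial>?W)
      = (\<integral>\<^sup>+ w. \<integral>\<^sup>+ v. (\<Sum>i<n. ennreal (v i) * ?acc c i r w) \<partial>F \<partial>Pi\<^sub>M ?I (\<lambda>_. F))"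
      using P.product_nn_integral_insert[of ?I c] k by simp
    also have "\<dots> = (\<integral>\<^sup>+ w. (\<Sum>i<n. (\<integral>\<^sup>+ v. ennreal (v i) \<partial>F) * ?acc c i r w) \<partial>Pi\<^sub>M ?I (\<lambda>_. F))"
    proof (intro nn_integral_cong)
      fix w
      have [measurable]: "(\<lambda>v. ennreal (v i)) \<in> borel_measurable F" if "i < n" for i
        using that by (intro measurable_compose[OF comp measurable_ennreal])
      have "(\<integral>\<^sup>+ v. (\<Sum>i<n. ennreal (v i) * ?acc c i r w) \<partial>F)
          = (\<Sum>i<n. \<integral>\<^sup>+ v. ennreal (v i) * ?acc c i r w \<partial>F)"
        by (intro nn_integral_sum) auto
      also have "\<dots> = (\<Sum>i<n. (\<integral>\<^sup>+ v. ennreal (v i) \<partial>F) * ?acc c i r w)"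
        by (intro sum.cong nn_integral_multc) auto
      finally show "(\<integral>\<^sup>+ v. (\<Sum>i<n. ennreal (v i) * ?acc c i r w) \<partial>F)
          = (\<Sum>i<n. (\<integral>\<^sup>+ v. ennreal (v i) \<partial>F) * ?acc c i r w)" .
    qed
    also have "\<dots> \<le> (\<integral>\<^sup>+ w. C \<partial>Pi\<^sub>M ?I (\<lambda>_. F))"
    proof (intro nn_integral_mono)
      fix w
      have "(\<Sum>i<n. (\<integral>\<^sup>+ v. ennreal (v i) \<partial>F) * ?acc c i r w) \<le> (\<Sum>i<n. C * ?acc c i r w)"
        using mean by (intro sum_mono mult_right_mono) auto
      also have "\<dots> \<le> C" by (rule sum_first_accepted_on_path_le)
      finally show "(\<Sum>i<n. (\<integral>\<^sup>+ v. ennreal (v i) \<partial>F) * ?acc c i r w) \<le> C" .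
    qed
    also have "\<dots> = C" by (simp add: PI.emeasure_space_1)
    finally show ?thesis .
  qed
  have "AE w in ?W. \<forall>i<n. w c i = 0 \<or> (\<forall>j\<le>i. w c j = p j)" if "c < k" for c
    using AE_PiM_component[of "{..<k}" "\<lambda>_. F" c, OF F.prob_space_axioms _ path] that by simp
  then have "AE w in ?W. \<forall>c\<in>{..<k}. \<forall>i<n. w c i = 0 \<or> (\<forall>j\<le>i. w c j = p j)"
    by (intro AE_finite_allI) auto
  then have "AE x in seed A \<Otimes>\<^sub>M ?W. \<forall>c\<in>{..<k}. \<forall>i<n. snd x c i = 0 \<or> (\<forall>j\<le>i. snd x c j = p j)"
    by (rule AE_pair_snd[rotated]) unfold_locales
  then have "algorithm_value n F k A
      \<le> (\<integral>\<^sup>+ (r, w). (\<Sum>c<k. \<Sum>i<n. ennreal (w c i) * ?acc c i r w) \<partial>(seed A \<Otimes>\<^sub>M ?W))"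
    unfolding algorithm_value_def case_prod_beta
    by (intro nn_integral_mono_AE, elim eventually_mono) (intro selected_value_le_path_sum, auto)
  also have "\<dots> = (\<Sum>c<k. \<integral>\<^sup>+ (r, w). (\<Sum>i<n. ennreal (w c i) * ?acc c i r w) \<partial>(seed A \<Otimes>\<^sub>M ?W))"
    using gain unfolding case_prod_beta by (intro nn_integral_sum) auto
  also have "\<dots> = (\<Sum>c<k. \<integral>\<^sup>+ r. \<integral>\<^sup>+ w. (\<Sum>i<n. ennreal (w c i) * ?acc c i r w) \<partial>?W \<partial>seed A)"
    using P.nn_integral_fst[OF gain] by (intro sum.cong) auto
  also have "\<dots> \<le> (\<Sum>c<k. \<integral>\<^sup>+ r. C \<partial>seed A)"
    using copy_le by (intro sum_mono nn_integral_mono) auto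
  also have "\<dots> = of_nat k * C"
    by (simp add: S.emeasure_space_1)
  finally show ?thesis .
qed

section \<open>The geometric ladder instance and its prophet value\<close>

text \<open>For \<omega> uniform on \<open>m ^ n\<close> points, the event that reward
  \<open>i\<close> is nonzero is a prefix of size \<open>m ^ (n - i)\<close>. It thus has
  probability \<open>1 / m ^ i\<close>, and the nesting of the prefixes produces the correlation
  between rewards.\<close>

definition ladder :: "nat \<Rightarrow> nat \<Rightarrow> nat \<Rightarrow> nat \<Rightarrow> real" where
  "ladder m n \<omega> = (\<lambda>i\<in>{..<n}. if \<omega> < m ^ (n - i) then real m ^ i else 0)"

definition ladder_instance :: "nat \<Rightarrow> nat \<Rightarrow> (nat \<Rightarrow> real) measure" where
  "ladder_instance m n =
     distr (measure_pmf (pmf_of_set {..<m ^ n})) (Pi\<^sub>M {..<n} (\<lambda>_. borel)) (ladder m n)"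

lemma measurable_ladder: "ladder m n \<in> measurable (measure_pmf q) (Pi\<^sub>M {..<n} (\<lambda>_. borel))"
  by (auto simp: ladder_def space_PiM)

text \<open>The thresholds \<open>m ^ (n - j)\<close> do not increase with \<open>j\<close>, so
  passing the one at \<open>i\<close> means passing all earlier ones.\<close>

lemma ladder_path:
  assumes "1 \<le> m" "i < n"
  shows "ladder m n \<omega> i = 0 \<or> (\<forall>j\<le>i. ladder m n \<omega> j = real m ^ j)"
proof (cases "\<omega> < m ^ (n - i)")
  case True
  have "\<omega> < m ^ (n - j)" if "j \<le> i" for j
    using True power_increasing[of "n - i" "n - j" m] that assms by linarith
  then show ?thesis using assms by (auto simp: ladder_def)
qed (use assms in \<open>simp add: ladder_def\<close>)

lemma AE_ladder_instance_path:
  assumes "1 \<le> m"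
  shows "AE v in ladder_instance m n. \<forall>i<n. v i = 0 \<or> (\<forall>j\<le>i. v j = real m ^ j)"
proof -
  \<comment> \<open>Quantifiers bounded by finite sets exhibit the event as a finite intersection,
    hence measurable.\<close>
  have meas: "{v \<in> space (Pi\<^sub>M {..<n} (\<lambda>_. borel)). \<forall>i\<in>{..<n}. v i = 0 \<or> (\<forall>j\<in>{..i}. v j = real m ^ j)}
      \<in> sets (Pi\<^sub>M {..<n} (\<lambda>_. borel :: real measure))"
    by (intro sets.sets_Collect_finite_All sets.sets_Collect_disj; measurable)
  have "AE v in ladder_instance m n. \<forall>i\<in>{..<n}. v i = 0 \<or> (\<forall>j\<in>{..i}. v j = real m ^ j)"
    unfolding ladder_instance_def using ladder_path[OF assms]
    by (subst AE_distr_iff[OF measurable_ladder meas]) (rule AE_I2, auto)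
  then show ?thesis by (simp only: Ball_def lessThan_iff atMost_iff)
qed

lemma correlated_instance_ladder:
  assumes "1 \<le> m"
  shows "correlated_instance n (ladder_instance m n)"
  unfolding correlated_instance_def
proof (intro conjI)
  show "prob_space (ladder_instance m n)"
    unfolding ladder_instance_def by (intro measure_pmf.prob_space_distr measurable_ladder)
  show "sets (ladder_instance m n) = sets (Pi\<^sub>M {..<n} (\<lambda>_. borel))"
    by (simp add: ladder_instance_def)
  show "AE v in ladder_instance m n. \<forall>i<n. 0 \<le> v i"
    using AE_ladder_instance_path[OF assms, of n]
    by eventually_elim (metis order_refl zero_le_power of_nat_0_le_iff)
qed

lemma nn_integral_ladder_component:
  assumes "1 \<le> m" "i < n"
  shows "(\<integral>\<^sup>+ v. ennreal (v i) \<partial>ladder_instance m n) = 1"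
proof -
  have ne: "{..<m ^ n} \<noteq> {}" using assms by (auto simp: lessThan_empty_iff)
  have sub: "{..<m ^ n} \<inter> {..<m ^ (n - i)} = {..<m ^ (n - i)}"
    using power_increasing[of "n - i" n m] assms by auto
  have "(\<integral>\<^sup>+ v. ennreal (v i) \<partial>ladder_instance m n)
      = (\<integral>\<^sup>+ \<omega>. ennreal (ladder m n \<omega> i) \<partial>measure_pmf (pmf_of_set {..<m ^ n}))"
    unfolding ladder_instance_def using assms
    by (intro nn_integral_distr measurable_ladder measurable_compose[OF _ measurable_ennreal] measurable_component_singleton) auto
  also have "\<dots> = (\<integral>\<^sup>+ \<omega>. ennreal (real m ^ i) * indicator {..<m ^ (n - i)} \<omega>
      \<partial>measure_pmf (pmf_of_set {..<m ^ n}))"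
    using assms by (intro nn_integral_cong) (auto simp: ladder_def indicator_def)
  also have "\<dots> = ennreal (real m ^ i) * emeasure (measure_pmf (pmf_of_set {..<m ^ n})) {..<m ^ (n - i)}"
    by (simp add: nn_integral_cmult)
  also have "\<dots> = ennreal (real m ^ i * (real m ^ (n - i) / real m ^ n))"
    using ne sub by (simp add: emeasure_pmf_of_set flip: ennreal_mult)
  also have "real m ^ i * (real m ^ (n - i) / real m ^ n) = 1"
    using assms by (simp add: power_add[symmetric])
  finally show ?thesis by simp
qed

text \<open>The left side telescopes: the term of index \<open>i\<close> contributes
  \<open>m ^ i - m ^ (i - 1)\<close> for positive \<open>i\<close>, so the exact value is
  \<open>m ^ l - 1 / m\<close>.\<close>

lemma sum_powers_le:
  fixes m :: real
  assumes "1 \<le> m"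
  shows "(1 - 1 / m) * (\<Sum>i\<le>l. m ^ i) \<le> m ^ l"
proof (induction l)
  case (Suc l)
  have "(1 - 1 / m) * (\<Sum>i\<le>Suc l. m ^ i) \<le> m ^ l + (1 - 1 / m) * m ^ Suc l"
    using Suc by (simp add: distrib_left)
  also have "\<dots> = m ^ Suc l" using assms by (simp add: field_simps)
  finally show ?case .
qed (use assms in simp)

text \<open>The last nonzero entry \<open>v l\<close> equals \<open>m ^ l\<close>, and the whole sum
  is at most the geometric sum up to \<open>l\<close>, which \<open>sum_powers_le\<close> compares
  with \<open>m ^ l\<close>.\<close>

lemma sum_ladder_le_Max:
  fixes m :: real and v :: "nat \<Rightarrow> real"
  assumes m: "1 \<le> m" and "1 \<le> n" and v: "\<And>i. i < n \<Longrightarrow> v i = 0 \<or> v i = m ^ i"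
  shows "(1 - 1 / m) * (\<Sum>i<n. v i) \<le> Max (v ` {..<n})"
proof (cases "\<exists>i<n. v i \<noteq> 0")
  case True
  define l where "l = Max {i. i < n \<and> v i \<noteq> 0}"
  have l: "l < n" "v l \<noteq> 0"
    using Max_in[of "{i. i < n \<and> v i \<noteq> 0}"] True by (auto simp: l_def)
  have "i \<le> l" if "i < n" "v i \<noteq> 0" for i
    using that by (auto simp: l_def intro!: Max_ge)
  then have "(\<Sum>i<n. v i) = (\<Sum>i\<le>l. v i)"
    using l by (intro sum.mono_neutral_right) auto
  also have "\<dots> \<le> (\<Sum>i\<le>l. m ^ i)"
    using v l m by (intro sum_mono) (metis atMost_iff le_less_trans order_refl zero_le_power zero_le_one order_trans)
  finally have "(1 - 1 / m) * (\<Sum>i<n. v i) \<le> (1 - 1 / m) * (\<Sum>i\<le>l. m ^ i)"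
    using m by (intro mult_left_mono) auto
  also have "\<dots> \<le> v l" using sum_powers_le[OF m] v l by metis
  also have "\<dots> \<le> Max (v ` {..<n})" using l by (intro Max_ge) auto
  finally show ?thesis .
next
  case False
  then have "v ` {..<n} = (\<lambda>_. 0) ` {..<n}" by (intro image_cong) auto
  also have "\<dots> = {0}" using \<open>1 \<le> n\<close> by (simp add: image_constant_conv lessThan_empty_iff)
  finally show ?thesis using False by simp
qed

text \<open>The almost sure bound of \<open>sum_ladder_le_Max\<close> is integrated; the expected
  sum is \<open>n\<close> because every reward has mean 1.\<close>

lemma prophet_value_ladder_ge:
  assumes "1 \<le> m" "1 \<le> n"
  shows "ennreal ((1 - 1 / real m) * real n) \<le> prophet_value n (ladder_instance m n)"
proof -
  let ?F = "ladder_instance m n"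
  have nonneg: "0 \<le> 1 - 1 / real m" using assms by simp
  have comp: "(\<lambda>v. v i) \<in> borel_measurable ?F" if "i < n" for i
    using that unfolding ladder_instance_def by (auto intro!: measurable_component_singleton)
  have "ennreal ((1 - 1 / real m) * real n) = ennreal (1 - 1 / real m) * (\<Sum>i<n. \<integral>\<^sup>+ v. ennreal (v i) \<partial>?F)"
    using assms nonneg by (simp add: nn_integral_ladder_component ennreal_mult ennreal_of_nat_eq_real_of_nat)
  also have "\<dots> = ennreal (1 - 1 / real m) * (\<integral>\<^sup>+ v. (\<Sum>i<n. ennreal (v i)) \<partial>?F)"
    by (subst nn_integral_sum) (auto intro: measurable_compose[OF comp measurable_ennreal])
  also have "\<dots> = (\<integral>\<^sup>+ v. ennreal (1 - 1 / real m) * (\<Sum>i<n. ennreal (v i)) \<partial>?F)"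
    by (intro nn_integral_cmult[symmetric] borel_measurable_sum)
      (auto intro: measurable_compose[OF comp measurable_ennreal])
  also have "\<dots> \<le> prophet_value n ?F"
    unfolding prophet_value_def
  proof (rule nn_integral_mono_AE, use AE_ladder_instance_path[OF assms(1), of n] in eventually_elim)
    case (elim v)
    then have v: "v i = 0 \<or> v i = real m ^ i" if "i < n" for i
      using that by blast
    then have "0 \<le> v i" if "i < n" for i using that by (metis order_refl zero_le_power of_nat_0_le_iff)
    then have "ennreal (1 - 1 / real m) * (\<Sum>i<n. ennreal (v i))
        = ennreal ((1 - 1 / real m) * (\<Sum>i<n. v i))"
      using nonneg by (subst sum_ennreal) (auto simp: ennreal_mult' sum_nonneg)
    also have "\<dots> \<le> ennreal (Max (v ` {..<n}))"
      using assms v by (intro ennreal_leI sum_ladder_le_Max) auto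
    finally show ?case .
  qed
  finally show ?thesis .
qed

section \<open>Comparison of the two bounds\<close>

theorem proposition6p1:
  fixes \<epsilon> :: real and n :: nat
  assumes "0 \<le> \<epsilon>" and "\<epsilon> < 1" and "1 \<le> n"
  shows "\<exists>F. correlated_instance n F \<and>
    (\<forall>A :: nat \<Rightarrow> 'r online_algorithm.
       (\<forall>k\<ge>1. valid_algorithm (n * k) (A k)) \<longrightarrow>
       ereal_of_enat (competition_complexity \<epsilon> n F A)
         \<ge> ereal (real n - real n * \<epsilon> - 1))"
proof (intro exI conjI allI impI)
  \<comment> \<open>With this base the prophet loses only \<open>n / ?m\<close>, which is below 1,
    against the ideal value \<open>n\<close>. This loss is the \<open>- 1\<close> in the
    claim.\<close>
  let ?m = "n + 1"
  let ?F = "ladder_instance ?m n"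
  show inst: "correlated_instance n ?F" by (intro correlated_instance_ladder) simp
  fix A :: "nat \<Rightarrow> 'r online_algorithm"
  assume A: "\<forall>k\<ge>1. valid_algorithm (n * k) (A k)"
  \<comment> \<open>Sufficiency is evaluated at exactly \<open>k\<close> copies, where the algorithm
    earns at most \<open>k\<close>.\<close>
  have bound: "real n - real n * \<epsilon> - 1 \<le> real k" if "sufficient_copies \<epsilon> n ?F A k" for k
  proof -
    have "ennreal ((1 - \<epsilon>) * ((1 - 1 / real ?m) * real n))
        = ennreal (1 - \<epsilon>) * ennreal ((1 - 1 / real ?m) * real n)"
      using assms by (intro ennreal_mult) auto
    also have "\<dots> \<le> ennreal (1 - \<epsilon>) * prophet_value n ?F"
      using assms by (intro mult_left_mono prophet_value_ladder_ge) auto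
    also have "\<dots> \<le> algorithm_value n ?F k (A k)"
      using that by (simp add: sufficient_copies_def)
    also have "\<dots> \<le> of_nat k * 1"
    proof (rule algorithm_value_le[OF inst AE_ladder_instance_path])
      show "valid_algorithm (n * k) (A k)" using A that by (simp add: sufficient_copies_def)
    qed (simp_all add: nn_integral_ladder_component)
    finally have "ennreal ((1 - \<epsilon>) * ((1 - 1 / real ?m) * real n)) \<le> ennreal (real k)"
      by (simp add: ennreal_of_nat_eq_real_of_nat)
    then have "(1 - \<epsilon>) * ((1 - 1 / real ?m) * real n) \<le> real k"
      by (subst (asm) ennreal_le_iff) auto
    moreover have "(1 - \<epsilon>) * (real n / real ?m) \<le> 1"
      using assms by (intro mult_le_one) auto
    then have "real n - real n * \<epsilon> - 1 \<le> (1 - \<epsilon>) * ((1 - 1 / real ?m) * real n)"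
      by (simp add: algebra_simps)
    ultimately show ?thesis by linarith
  qed
  show "ereal (real n - real n * \<epsilon> - 1) \<le> ereal_of_enat (competition_complexity \<epsilon> n ?F A)"
  proof (cases "\<exists>k. sufficient_copies \<epsilon> n ?F A k")
    case True
    then show ?thesis
      using bound[OF LeastI_ex[OF True]] by (simp add: competition_complexity_def)
  qed (simp add: competition_complexity_def)
qed

end
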